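(* Consider the smooth connection on $\mathbb{H}_{\mathbb{C}}=M_2(\mathbb{C})$ with connection potential $$A=(1+Z^*Z)^{-1}Z^*dZ.$$ Its restriction to $\mathbb{H}\subset\mathbb{H}_{\mathbb{C}}$ gives the basic Euclidean instanton, and its restriction to $\mathbb{H}_{\mathbb{R}}\subset\mathbb{H}_{\mathbb{C}}$ gives the basic split anti-instanton.
   Context: $\mathbb{H}_{\mathbb{C}}=M_2(\mathbb{C})$, with elements $Z=\begin{pmatrix} z_{11} & z_{12} \\ z_{21} & z_{22} \end{pmatrix}$; $Z^t$ is the transpose, $Z^*$ the conjugate transpose, $dZ=(dz_{ij})$. The real forms are $\mathbb{H}=\{Z: z_{22}=\bar z_{11},\ z_{12}=-\bar z_{21}\}$ (quaternions) and $\mathbb{H}_{\mathbb{R}}=M_2(\mathbb{R})$ (split quaternions). For a quaternion $x\in\mathbb{H}$, written $x=(x_1,x_2,x_3,x_4)\leftrightarrow\begin{pmatrix} x_1+ix_4 & x_2+ix_3 \\ -x_2+ix_3 & x_1-ix_4 \end{pmatrix}$, the conjugate is $\bar x=(x_1,-x_2,-x_3,-x_4)$. The basic Euclidean instanton is the connection on $\mathbb{H}$ with potential $(1+\bar xx)^{-1}\bar x\,dx$. The basic split anti-instanton is the connection on $\mathbb{H}_{\mathbb{R}}$ with potential $(1+X^tX)^{-1}X^tdX$. *)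

theory Defs
  imports "HOL-Analysis.Analysis" "HOL-Library.FuncSet"
begin

section \<open>Complex, Euclidean and split quaternions\<close>

type_synonym HC = "complex^2^2"

definition conj_transpose :: "HC \<Rightarrow> HC" where
  "conj_transpose Z = (\<chi> i j. cnj (Z $ j $ i))"

definition HH :: "HC set" where
  "HH = {Z. Z $ 2 $ 2 = cnj (Z $ 1 $ 1) \<and> Z $ 1 $ 2 = - cnj (Z $ 2 $ 1)}"

definition HR :: "HC set" where
  "HR = {Z. \<forall>i j. Z $ i $ j \<in> \<real>}"

fun quat :: "real \<times> real \<times> real \<times> real \<Rightarrow> HC" where
  "quat (x1, x2, x3, x4) =
     vector [vector [Complex x1 x4, Complex x2 x3],
             vector [Complex (- x2) x3, Complex x1 (- x4)]]"

fun coord_conj :: "real \<times> real \<times> real \<times> real \<Rightarrow> real \<times> real \<times> real \<times> real" where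
  "coord_conj (x1, x2, x3, x4) = (x1, - x2, - x3, - x4)"

text \<open>Quaternionic conjugation, defined through the coordinates; only its values on \<open>HH\<close>
  are meaningful, since \<open>quat\<close> is a bijection onto \<open>HH\<close>.\<close>

definition qconj :: "HC \<Rightarrow> HC" where
  "qconj x = quat (coord_conj (inv quat x))"

lemma inj_quat: "inj quat"
proof (rule injI)
  fix x y assume "quat x = quat y"
  then show "x = y"
    by (cases x; cases y) (auto simp: vec_eq_iff forall_2)
qed

lemma range_quat: "range quat = HH"
proof
  show "range quat \<subseteq> HH"
    by (auto simp: HH_def complex_eq_iff)
  show "HH \<subseteq> range quat"
  proof
    fix Z assume "Z \<in> HH"
    then have "Z = quat (Re (Z$1$1), Re (Z$1$2), Im (Z$1$2), Im (Z$1$1))"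
      by (auto simp: HH_def vec_eq_iff forall_2 complex_eq_iff)
    then show "Z \<in> range quat" by blast
  qed
qed

lemma qconj_quat: "qconj (quat x) = quat (coord_conj x)"
  by (simp add: qconj_def inj_quat)

lemma subspace_HH: "subspace HH"
  by (auto simp: subspace_def HH_def complex_eq_iff)

lemma subspace_HR: "subspace HR"
  by (auto simp: subspace_def HR_def complex_is_Real_iff)


section \<open>Smooth connections\<close>

text \<open>On a finite-dimensional space, \<open>f\<close> is of class \<open>C\<^sup>n\<^sup>+\<^sup>1\<close> iff it is differentiable everywhere and
  all its directional derivatives are of class \<open>C\<^sup>n\<close>. Differentiability is over the reals,
  also for complex matrices.\<close>

primrec Ck :: "nat \<Rightarrow> ('a::euclidean_space \<Rightarrow> 'b::real_normed_vector) \<Rightarrow> bool" where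
  "Ck 0 f \<longleftrightarrow> continuous_on UNIV f"
| "Ck (Suc n) f \<longleftrightarrow>
     (\<forall>x. f differentiable at x) \<and> (\<forall>v. Ck n (\<lambda>x. frechet_derivative f (at x) v))"

definition smooth :: "('a::euclidean_space \<Rightarrow> 'b::real_normed_vector) \<Rightarrow> bool" where
  "smooth f \<longleftrightarrow> (\<forall>n. Ck n f)"

text \<open>A connection \<open>d + A\<close> on a trivial rank-2 bundle is recorded by its potential, the
  matrix-valued 1-form \<open>A\<close>; \<open>A Z W\<close> is the value at the point \<open>Z\<close> on the tangent vector \<open>W\<close>.
  The tangent spaces of a real vector space are identified with the space itself, so that
  \<open>dZ\<close> evaluated at \<open>W\<close> is \<open>W\<close>.\<close>

type_synonym potential = "HC \<Rightarrow> HC \<Rightarrow> HC"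

definition smooth_connection :: "potential \<Rightarrow> bool" where
  "smooth_connection A \<longleftrightarrow> (\<forall>Z. linear (A Z)) \<and> (\<forall>W. smooth (\<lambda>Z. A Z W))"

text \<open>Restriction (pullback along the inclusion) to a real linear subspace \<open>S\<close>, whose tangent
  space at each of its points is \<open>S\<close>.\<close>

definition restrict_connection :: "potential \<Rightarrow> HC set \<Rightarrow> potential" where
  "restrict_connection A S = (\<lambda>x\<in>S. \<lambda>v\<in>S. A x v)"

definition complex_potential :: potential where
  "complex_potential Z dZ =
     matrix_inv (mat 1 + conj_transpose Z ** Z) ** conj_transpose Z ** dZ"

definition basic_euclidean_instanton :: potential where
  "basic_euclidean_instanton =
     (\<lambda>x\<in>HH. \<lambda>dx\<in>HH. matrix_inv (mat 1 + qconj x ** x) ** qconj x ** dx)"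

definition basic_split_anti_instanton :: potential where
  "basic_split_anti_instanton =
     (\<lambda>X\<in>HR. \<lambda>dX\<in>HR. matrix_inv (mat 1 + transpose X ** X) ** transpose X ** dX)"

end

theory Submission
  imports Defs
begin

text \<open>
  By Cauchy--Binet, the determinant of \<open>1 + Z\<^sup>*Z\<close> is
  \<open>1 + \<bar>z\<^sub>1\<^sub>1\<bar>\<^sup>2 + \<bar>z\<^sub>1\<^sub>2\<bar>\<^sup>2 + \<bar>z\<^sub>2\<^sub>1\<bar>\<^sup>2 + \<bar>z\<^sub>2\<^sub>2\<bar>\<^sup>2 + \<bar>det Z\<bar>\<^sup>2\<close>, which never vanishes. By the
  adjugate formula the potential is therefore built from the entries of \<open>Z\<close> and their conjugates by
  ring operations and division by a nonvanishing function, so it is smooth. The conjugate transpose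
  is quaternionic conjugation on \<open>HH\<close> and the transpose on \<open>HR\<close>.
\<close>

section \<open>Calculus of smooth functions\<close>

text \<open>By uniqueness of derivatives, any explicit formula \<open>f'\<close> may stand in for
  \<open>frechet_derivative\<close>, so the usual differentiation rules drive every induction on the
  order.\<close>

lemma Ck_SucI:
  assumes "\<And>x. (f has_derivative f' x) (at x)" and "\<And>v. Ck n (\<lambda>x. f' x v)"
  shows "Ck (Suc n) f"
proof -
  have "frechet_derivative f (at x) = f' x" for x
    using frechet_derivative_at[OF assms(1)] by simp
  then show ?thesis
    using assms by (auto intro: differentiableI)
qed

lemma Ck_SucD:
  assumes "Ck (Suc n) f"
  shows "\<exists>f'. (\<forall>x. (f has_derivative f' x) (at x)) \<and> (\<forall>v. Ck n (\<lambda>x. f' x v))"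
  using assms by (auto simp: frechet_derivative_works)

text \<open>Product and quotient rules leave some factors undifferentiated; this lowers their order
  to that of the induction hypothesis.\<close>

lemma Ck_Suc_imp_Ck: "Ck (Suc n) f \<Longrightarrow> Ck n f"
proof (induction n arbitrary: f)
  case 0
  then show ?case
    by (auto simp: continuous_on_eq_continuous_within intro: differentiable_imp_continuous_within)
next
  case (Suc n)
  then show ?case
    by (metis Ck.simps(2))
qed

lemma Ck_const: "Ck n (\<lambda>x. c)"
proof (induction n arbitrary: c)
  case (Suc n)
  show ?case
    by (rule Ck_SucI[where f' = "\<lambda>x v. 0"]) (auto intro: Suc)
qed auto

lemma Ck_linear:
  assumes "bounded_linear f"
  shows "Ck n f"
proof (cases n)
  case 0
  then show ?thesis
    using assms by (simp add: linear_continuous_on)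
next
  case (Suc m)
  \<comment> \<open>The derivative of \<open>f\<close> is \<open>f\<close> itself at every point, so
    each directional derivative is constant in \<open>x\<close>.\<close>
  then show ?thesis
    using Ck_SucI[of f "\<lambda>x. f"] bounded_linear_imp_has_derivative[OF assms] Ck_const by blast
qed

lemma Ck_add:
  assumes "Ck n f" "Ck n g"
  shows "Ck n (\<lambda>x. f x + g x)"
  using assms
proof (induction n arbitrary: f g)
  case 0
  then show ?case by (auto intro: continuous_on_add)
next
  case (Suc n)
  obtain f' where f': "\<And>x. (f has_derivative f' x) (at x)" "\<And>v. Ck n (\<lambda>x. f' x v)"
    using Ck_SucD[OF Suc.prems(1)] by blast
  obtain g' where g': "\<And>x. (g has_derivative g' x) (at x)" "\<And>v. Ck n (\<lambda>x. g' x v)"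
    using Ck_SucD[OF Suc.prems(2)] by blast
  show ?case
    by (rule Ck_SucI[where f' = "\<lambda>x v. f' x v + g' x v"])
      (auto intro: has_derivative_add f' g' Suc.IH)
qed

lemma (in bounded_linear) Ck_comp:
  assumes "Ck n g"
  shows "Ck n (\<lambda>x. f (g x))"
  using assms
proof (induction n arbitrary: g)
  case 0
  then show ?case by (auto intro: continuous_on)
next
  case (Suc n)
  obtain g' where g': "\<And>x. (g has_derivative g' x) (at x)" "\<And>v. Ck n (\<lambda>x. g' x v)"
    using Ck_SucD[OF Suc.prems] by blast
  show ?case
    by (rule Ck_SucI[where f' = "\<lambda>x v. f (g' x v)"]) (auto intro: has_derivative g' Suc.IH)
qed

lemma (in bounded_bilinear) Ck_comp:
  assumes "Ck n f" "Ck n g"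
  shows "Ck n (\<lambda>x. prod (f x) (g x))"
  using assms
proof (induction n arbitrary: f g)
  case 0
  then show ?case by (auto intro: continuous_on)
next
  case (Suc n)
  obtain f' where f': "\<And>x. (f has_derivative f' x) (at x)" "\<And>v. Ck n (\<lambda>x. f' x v)"
    using Ck_SucD[OF Suc.prems(1)] by blast
  obtain g' where g': "\<And>x. (g has_derivative g' x) (at x)" "\<And>v. Ck n (\<lambda>x. g' x v)"
    using Ck_SucD[OF Suc.prems(2)] by blast
  have "Ck n f" "Ck n g"
    using Suc.prems by (blast intro: Ck_Suc_imp_Ck)+
  then show ?case
    by (intro Ck_SucI[where f' = "\<lambda>x v. prod (f x) (g' x v) + prod (f' x v) (g x)"]
        FDERIV f' g' Ck_add Suc.IH)
qed

text \<open>The derivative of the inverse is a product of \<open>f'\<close> and the inverse itself,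
  so the induction keeps \<open>f\<close> fixed and feeds the inverse back at the lower
  order.\<close>

lemma Ck_inverse:
  fixes f :: "'a::euclidean_space \<Rightarrow> 'b::real_normed_div_algebra"
  assumes "Ck n f" and nz: "\<And>x. f x \<noteq> 0"
  shows "Ck n (\<lambda>x. inverse (f x))"
  using assms(1)
proof (induction n)
  case 0
  then show ?case using nz by (auto intro: continuous_on_inverse)
next
  case (Suc n)
  obtain f' where f': "\<And>x. (f has_derivative f' x) (at x)" "\<And>v. Ck n (\<lambda>x. f' x v)"
    using Ck_SucD[OF Suc.prems] by blast
  have inv: "Ck n (\<lambda>x. inverse (f x))"
    using Suc by (blast intro: Ck_Suc_imp_Ck)
  show ?case
  proof (rule Ck_SucI)
    show "((\<lambda>x. inverse (f x)) has_derivative (\<lambda>v. - (inverse (f x) * f' x v * inverse (f x)))) (at x)"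
      for x
      by (rule Deriv.has_derivative_inverse[OF nz f'(1)])
    show "Ck n (\<lambda>x. - (inverse (f x) * f' x v * inverse (f x)))" for v
      by (intro bounded_linear.Ck_comp[OF bounded_linear_minus[OF bounded_linear_ident]]
          bounded_bilinear.Ck_comp[OF bounded_bilinear_mult] inv f')
  qed
qed

lemma Ck_sum:
  assumes "\<And>i. i \<in> I \<Longrightarrow> Ck n (f i)"
  shows "Ck n (\<lambda>x. \<Sum>i\<in>I. f i x)"
  using assms by (induction I rule: infinite_finite_induct) (auto intro: Ck_const Ck_add)

text \<open>A vector is the sum of its components placed along the axes, and each
  \<open>axis i\<close> is bounded linear.\<close>

lemma Ck_vec:
  fixes f :: "'a::euclidean_space \<Rightarrow> 'b::euclidean_space^'n"
  assumes "\<And>i. Ck n (\<lambda>x. f x $ i)"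
  shows "Ck n f"
proof -
  have "bounded_linear (axis i :: 'b \<Rightarrow> 'b^'n)" for i
    by (intro linear_conv_bounded_linear[THEN iffD1] linearI) (auto simp: axis_def vec_eq_iff)
  from bounded_linear.Ck_comp[OF this assms]
  have "Ck n (\<lambda>x. \<Sum>i\<in>UNIV. (axis i (f x $ i) :: 'b^'n))"
    by (rule Ck_sum)
  moreover have "(\<Sum>i\<in>UNIV. axis i (y $ i)) = y" for y :: "'b^'n"
    by (simp add: vec_eq_iff axis_def)
  ultimately show ?thesis by simp
qed

lemma Ck_vec_nth: "Ck n f \<Longrightarrow> Ck n (\<lambda>x. f x $ i)"
  by (rule bounded_linear.Ck_comp[OF bounded_linear_vec_nth])

lemmas Ck_mult = bounded_bilinear.Ck_comp[OF bounded_bilinear_mult]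

lemma Ck_minus: "Ck n f \<Longrightarrow> Ck n (\<lambda>x. - f x)"
  by (rule bounded_linear.Ck_comp[OF bounded_linear_minus[OF bounded_linear_ident]])

lemma Ck_diff: "Ck n f \<Longrightarrow> Ck n g \<Longrightarrow> Ck n (\<lambda>x. f x - g x)"
  using Ck_add[OF _ Ck_minus, of n f g] by simp


section \<open>Matrices\<close>

text \<open>\<open>matrix_inv\<close> is a choice of two-sided inverse. For square matrices over a
  field a right inverse is two-sided, and inverses are unique.\<close>

lemma matrix_inv_eqI:
  fixes A B :: "'a::field^'n^'n"
  assumes "A ** B = mat 1"
  shows "matrix_inv A = B"
proof -
  have "A ** B = mat 1 \<and> B ** A = mat 1"
    using assms matrix_left_right_inverse by blast
  then have "A ** matrix_inv A = mat 1 \<and> matrix_inv A ** A = mat 1"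
    unfolding matrix_inv_def by (rule someI)
  then show ?thesis
    by (metis assms matrix_mul_assoc matrix_mul_lid matrix_mul_rid)
qed

lemma matrix_inv_2:
  fixes A :: "'a::field^2^2"
  assumes "det A \<noteq> 0"
  shows "matrix_inv A = vector
    [vector [A$2$2 * inverse (det A), - A$1$2 * inverse (det A)],
     vector [- A$2$1 * inverse (det A), A$1$1 * inverse (det A)]]"
proof (rule matrix_inv_eqI)
  define d where "d = inverse (det A)"
  have "(A$1$1 * A$2$2 - A$1$2 * A$2$1) * d = 1"
    using assms by (simp add: d_def det_2)
  then show "A ** vector
    [vector [A$2$2 * inverse (det A), - A$1$2 * inverse (det A)],
     vector [- A$2$1 * inverse (det A), A$1$1 * inverse (det A)]] = mat 1"
    unfolding d_def[symmetric]
    by (simp add: vec_eq_iff forall_2 matrix_matrix_mult_def sum_2 mat_def algebra_simps)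
qed

lemma Ck_matrix_mult:
  fixes f :: "'a::euclidean_space \<Rightarrow> complex^'n^'m" and g :: "'a \<Rightarrow> complex^'k^'n"
  assumes "Ck n f" "Ck n g"
  shows "Ck n (\<lambda>x. f x ** g x)"
  by (intro Ck_vec) (simp add: matrix_matrix_mult_def Ck_sum Ck_mult Ck_vec_nth assms)

lemma Ck_matrix_inv_2:
  fixes f :: "'a::euclidean_space \<Rightarrow> complex^2^2"
  assumes f: "Ck n f" and nz: "\<And>x. det (f x) \<noteq> 0"
  shows "Ck n (\<lambda>x. matrix_inv (f x))"
proof -
  have entry: "Ck n (\<lambda>x. f x $ i $ j)" for i j
    by (intro Ck_vec_nth f)
  have "Ck n (\<lambda>x. det (f x))"
    unfolding det_2 by (intro Ck_diff Ck_mult entry)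
  then have inv: "Ck n (\<lambda>x. inverse (det (f x)))"
    by (rule Ck_inverse[OF _ nz])
  have "Ck n (\<lambda>x. matrix_inv (f x) $ i $ j)" for i j
    using exhaust_2[of i] exhaust_2[of j]
    by (auto simp: matrix_inv_2[OF nz] simp del: mult_minus_left intro!: Ck_mult Ck_minus entry inv)
  then show ?thesis
    by (intro Ck_vec)
qed

lemma Ck_conj_transpose: "Ck n conj_transpose"
  by (intro Ck_vec)
    (simp add: conj_transpose_def bounded_linear.Ck_comp[OF bounded_linear_cnj]
      Ck_vec_nth Ck_linear[OF bounded_linear_ident])

lemma det_one_plus_conj_transpose_mult:
  fixes Z :: HC
  shows "det (mat 1 + conj_transpose Z ** Z) = of_real (1 + (cmod (Z$1$1))\<^sup>2 + (cmod (Z$1$2))\<^sup>2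
    + (cmod (Z$2$1))\<^sup>2 + (cmod (Z$2$2))\<^sup>2 + (cmod (det Z))\<^sup>2)"
  \<comment> \<open>Keeping \<open>of_real\<close> outside the squares lets
    \<open>complex_norm_square\<close> turn each squared modulus into
    \<open>z * cnj z\<close>.\<close>
  by (simp add: det_2 mat_def matrix_matrix_mult_def conj_transpose_def sum_2
      complex_norm_square algebra_simps del: of_real_power)

lemma det_one_plus_conj_transpose_mult_nonzero: "det (mat 1 + conj_transpose Z ** Z) \<noteq> 0"
proof -
  have "0 < 1 + (cmod (Z$1$1))\<^sup>2 + (cmod (Z$1$2))\<^sup>2
    + (cmod (Z$2$1))\<^sup>2 + (cmod (Z$2$2))\<^sup>2 + (cmod (det Z))\<^sup>2"
    by (intro add_pos_nonneg) auto
  then show ?thesis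
    unfolding det_one_plus_conj_transpose_mult of_real_eq_0_iff by linarith
qed

lemma conj_transpose_HH:
  assumes "Z \<in> HH"
  shows "conj_transpose Z = qconj Z"
proof -
  \<comment> \<open>Since \<open>qconj\<close> is defined through \<open>inv quat\<close>, the
    comparison is made in coordinates; \<open>quat\<close> maps onto \<open>HH\<close>.\<close>
  have "conj_transpose (quat x) = qconj (quat x)" for x
    unfolding qconj_quat
    by (cases x) (simp add: conj_transpose_def vec_eq_iff forall_2 complex_eq_iff)
  then show ?thesis
    using assms unfolding range_quat[symmetric] by auto
qed

lemma conj_transpose_HR: "Z \<in> HR \<Longrightarrow> conj_transpose Z = transpose Z"
  by (simp add: HR_def conj_transpose_def transpose_def Reals_cnj_iff)

lemma smooth_connection_complex_potential: "smooth_connection complex_potential"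
  unfolding smooth_connection_def smooth_def
proof (intro conjI allI)
  show "linear (complex_potential Z)" for Z
    by (rule linearI)
      (simp_all add: complex_potential_def vec_eq_iff matrix_matrix_mult_def
        sum.distrib distrib_left scaleR_sum_right)
  \<comment> \<open>With the tangent vector \<open>W\<close> frozen, \<open>Ck_const\<close> covers
    both \<open>mat 1\<close> and \<open>W\<close>.\<close>
  have "Ck n (\<lambda>Z. matrix_inv (mat 1 + conj_transpose Z ** Z) ** conj_transpose Z ** W)" for n W
    by (intro Ck_matrix_mult Ck_matrix_inv_2 Ck_add Ck_const Ck_conj_transpose
        Ck_linear[OF bounded_linear_ident] det_one_plus_conj_transpose_mult_nonzero)
  then show "Ck n (\<lambda>Z. complex_potential Z W)" for n W
    by (simp add: complex_potential_def)
qed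

theorem proposition2p4:
  shows "(\<forall>Z :: HC. invertible (mat 1 + conj_transpose Z ** Z))
    \<and> smooth_connection complex_potential
    \<and> restrict_connection complex_potential HH = basic_euclidean_instanton
    \<and> restrict_connection complex_potential HR = basic_split_anti_instanton"
proof (intro conjI allI)
  show "invertible (mat 1 + conj_transpose Z ** Z)" for Z :: HC
    by (simp add: invertible_det_nz det_one_plus_conj_transpose_mult_nonzero)
  show "smooth_connection complex_potential"
    by (rule smooth_connection_complex_potential)
  show "restrict_connection complex_potential HH = basic_euclidean_instanton"
    unfolding restrict_connection_def basic_euclidean_instanton_def
    \<comment> \<open>Applied twice: to the base point, then to the tangent vector. Off the subspace
      both sides are \<open>undefined\<close>.\<close>
    by (intro restrict_ext) (simp add: complex_potential_def conj_transpose_HH)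
  show "restrict_connection complex_potential HR = basic_split_anti_instanton"
    unfolding restrict_connection_def basic_split_anti_instanton_def
    by (intro restrict_ext) (simp add: complex_potential_def conj_transpose_HR)
qed

end
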